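(* Let $\langle X_i\rangle_{i\in I}$ be a sequence of compacta, let $X$ be a homogeneous compactum, and let $h\colon\prod_{i\in I}X_i\to X$ be a continuous surjection. If there is a regular cardinal $\kappa$ such that $w(X_i)<\kappa\leq w(X)$ for all $i\in I$, then every base of $X$ contains a subset that is a $\mu^{\mathrm{op}}$-like base of $X$, where $\mu=\sup_{i\in I}w(X_i)$. Otherwise, $w(X)\leq\sup_{i\in I}w(X_i)$ and every base of $X$ contains a subset that is a $(w(X)^+)^{\mathrm{op}}$-like base of $X$.
   Context: A compactum is a compact Hausdorff space; $w(\cdot)$ denotes weight. Families of open sets are ordered by inclusion; a family is $\lambda^{\mathrm{op}}$-like if no member is contained in $\lambda$-many members. *)

theory Defs
  imports "HOL-Analysis.Analysis"
begin

unbundle cardinal_syntax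

definition compactum :: "'a topology \<Rightarrow> bool" where
  "compactum X \<longleftrightarrow> compact_space X \<and> Hausdorff_space X"

definition homogeneous_space :: "'a topology \<Rightarrow> bool" where
  "homogeneous_space X \<longleftrightarrow>
     (\<forall>x\<in>topspace X. \<forall>y\<in>topspace X. \<exists>f. homeomorphic_map X X f \<and> f x = y)"

definition is_base :: "'a topology \<Rightarrow> 'a set set \<Rightarrow> bool" where
  "is_base X B \<longleftrightarrow> openin X = arbitrary union_of (\<lambda>U. U \<in> B)"

text \<open>Weight (with the usual convention that cardinal functions are infinite):
  w(X) = omega + min { |B| : B a base of X }, as a cardinal (well-order relation).\<close>
definition weight :: "'a topology \<Rightarrow> ('a set + nat) rel" where
  "weight X = card_of (SOME B. is_base X B \<and> (\<forall>B'. is_base X B' \<longrightarrow> card_of B \<le>o card_of B')) +c natLeq"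

definition card_sup :: "'b rel set \<Rightarrow> 'b rel \<Rightarrow> bool" where
  "card_sup S mu \<longleftrightarrow> Card_order mu \<and> (\<forall>r\<in>S. r \<le>o mu) \<and>
     (\<forall>nu :: 'b rel. Card_order nu \<and> (\<forall>r\<in>S. r \<le>o nu) \<longrightarrow> mu \<le>o nu)"

definition op_like :: "'k rel \<Rightarrow> 'a set set \<Rightarrow> bool" where
  "op_like lam F \<longleftrightarrow> (\<forall>U\<in>F. card_of {V\<in>F. U \<subseteq> V} <o lam)"

definition regular_cardinal :: "'k rel \<Rightarrow> bool" where
  "regular_cardinal k \<longleftrightarrow> Cinfinite k \<and> regularCard k"

end

theory Submission
  imports Defs
begin

text \<open>In the first case every base of \<open>X\<close> even contains an \<open>\<omega>\<^sup>o\<^sup>p\<close>-like base. Call a basic open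
  box of the product rich if its image is somewhere dense in \<open>X\<close>; every nonempty open subset of \<open>X\<close>
  contains the image of a rich box. By homogeneity and a Gerlits-type argument all points of \<open>X\<close>
  have \<open>\<pi>\<close>-character \<open>w(X)\<close>, so if \<open>|J| < w(X)\<close> then each point has a neighbourhood containing the
  image of no rich box supported by \<open>J\<close>.

  A base is then selected by transfinite recursion over \<open>w(X)\<close> many tasks \<open>t = (U, V)\<close> with
  \<open>cl U \<subseteq> V\<close>: cover \<open>cl U\<close> by finitely many members of the given base inside \<open>V\<close>. These members are chosen
  so small that any rich box mapped into one of them must mention a coordinate in \<open>N\<^sub>t - \<Union>\<^sub>s\<^sub><\<^sub>t N\<^sub>s\<close>
  for some finite \<open>N\<^sub>t\<close>. These sets of coordinates are disjoint for distinct tasks and a box mentions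
  only finitely many coordinates, so every nonempty open set lies in only finitely many of the
  selected sets.\<close>

subsection \<open>Cardinals and weight\<close>

lemma finite_ordLess_Cinfinite: "finite A \<Longrightarrow> Cinfinite r \<Longrightarrow> |A| <o r"
  by (rule Cfinite_ordLess_Cinfinite) (auto simp: cfinite_def Field_card_of card_of_card_order_on)

text \<open>Regularity of \<open>r\<close> is avoided: an infinite union of finite sets is no larger
  than its index set. The bound is later applied with the weight, which may be singular, in the
  place of \<open>r\<close>.\<close>

lemma UN_finite_ordLess_Cinfinite:
  assumes "Cinfinite r" "|A| <o r" "\<And>a. a \<in> A \<Longrightarrow> finite (F a)"
  shows "|\<Union>a\<in>A. F a| <o r"
proof (cases "finite A")
  case True
  then have "finite (\<Union>a\<in>A. F a)"
    using assms(3) by blast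
  then show ?thesis
    using assms(1) by (rule finite_ordLess_Cinfinite)
next
  case False
  then have "\<forall>a\<in>A. |F a| \<le>o |A|"
    using assms(3)
    by (auto intro!: ordLess_imp_ordLeq finite_ordLess_Cinfinite
        simp: cinfinite_def Field_card_of card_of_card_order_on)
  then have "|\<Union>a\<in>A. F a| \<le>o |A|"
    using False by (intro card_of_UNION_ordLeq_infinite) (auto intro: card_of_mono1)
  then show ?thesis
    using assms(2) ordLeq_ordLess_trans by blast
qed

lemma is_base_iff:
  "is_base X B \<longleftrightarrow> (\<forall>V\<in>B. openin X V) \<and>
     (\<forall>U x. openin X U \<and> x \<in> U \<longrightarrow> (\<exists>V\<in>B. x \<in> V \<and> V \<subseteq> U))"
  unfolding is_base_def openin_topology_base_unique by (auto simp: Bex_def)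

lemma is_base_openin: "is_base X B \<Longrightarrow> V \<in> B \<Longrightarrow> openin X V"
  by (simp add: is_base_iff)

lemma is_base_nbhd:
  assumes "is_base X B" "openin X U" "x \<in> U"
  obtains V where "V \<in> B" "x \<in> V" "V \<subseteq> U"
  using assms unfolding is_base_iff by metis

lemma compactum_shrink:
  assumes "compactum X" "openin X U" "x \<in> U"
  obtains V where "openin X V" "x \<in> V" "X closure_of V \<subseteq> U"
proof -
  have "regular_space X"
    using assms(1) by (simp add: compactum_def compact_Hausdorff_imp_regular_space)
  then have "neighbourhood_base_of (closedin X) X"
    by (simp add: neighbourhood_base_of_closedin)
  then obtain V K where "openin X V" "closedin X K" "x \<in> V" "V \<subseteq> K" "K \<subseteq> U"
    using assms(2,3) unfolding neighbourhood_base_of by meson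
  then show thesis
    using that closure_of_minimal by (metis subset_trans)
qed

lemma interior_of_Union_closedin_eq_empty:
  assumes "finite \<F>" "\<And>K. K \<in> \<F> \<Longrightarrow> closedin X K \<and> X interior_of K = {}"
  shows "X interior_of (\<Union>\<F>) = {}"
  using assms
proof (induction rule: finite_induct)
  case empty
  then show ?case by simp
next
  case (insert K \<F>)
  then have "closedin X K" "X interior_of K = {}" "X interior_of (\<Union>\<F>) = {}"
    by auto
  then show ?case
    by (simp add: interior_of_union_eq_empty)
qed

text \<open>Cardinals are well-ordered, so the least size of a base is attained; this gives the
  \<open>SOME\<close> in \<open>weight\<close> its meaning.\<close>

lemma ex_minimal_base:
  "\<exists>B. is_base X B \<and> (\<forall>B'. is_base X B' \<longrightarrow> |B| \<le>o |B'| )"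
proof -
  have "is_base X (Collect (openin X))"
    by (auto simp: is_base_iff)
  then have "card_of ` Collect (is_base X) \<noteq> {}"
    by auto
  moreover have "\<forall>r \<in> card_of ` Collect (is_base X). Card_order r"
    by (auto simp: card_of_Card_order)
  ultimately obtain r where "r \<in> card_of ` Collect (is_base X)"
    "\<forall>r' \<in> card_of ` Collect (is_base X). r \<le>o r'"
    using exists_minim_Card_order by metis
  then show ?thesis by auto
qed

lemma weight_base:
  obtains B where "is_base X B" "weight X = |B| +c natLeq"
    "\<And>B'. is_base X B' \<Longrightarrow> |B| \<le>o |B'|"
  using someI_ex[OF ex_minimal_base[of X]] that by (auto simp: weight_def)

lemma Cinfinite_weight: "Cinfinite (weight X)"
  by (metis weight_base Cinfinite_csum natLeq_Cinfinite)

lemma ex_base_le_weight: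
  obtains B where "is_base X B" "|B| \<le>o weight X"
  by (metis weight_base ordLeq_csum1 card_of_Card_order)

text \<open>\<open>weight\<close> adds \<open>natLeq\<close> to the least size of a base, hence the
  assumption \<open>natLeq <o t\<close>; a sum of two cardinals below an infinite \<open>t\<close>
  stays below \<open>t\<close>.\<close>

lemma weight_less_base:
  assumes "is_base X B" "|B| <o t" "natLeq <o t" "Cinfinite t"
  shows "weight X <o t"
proof -
  obtain B0 where B0: "is_base X B0" "weight X = |B0| +c natLeq" "|B0| \<le>o |B|"
    using weight_base assms(1) by metis
  have "|B0| <o t"
    using B0(3) assms(2) ordLeq_ordLess_trans by blast
  then show ?thesis
    unfolding B0(2)
    by (rule ordLess_ordIso_trans[OF csum_mono_strict[OF card_of_Card_order natLeq_Card_order assms(4,4) _ assms(3)]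
          csum_absorb1[OF assms(4) ordLeq_refl]]) (use assms(4) in auto)
qed

section \<open>Small sets relative to an uncountable regular cardinal\<close>

locale uncountable_regular =
  fixes \<tau> :: "'k rel"
  assumes regular: "regular_cardinal \<tau>" and uncountable: "natLeq <o \<tau>"
begin

lemma Cinfinite: "Cinfinite \<tau>"
  using regular by (simp add: regular_cardinal_def)

lemma stable: "stable \<tau>"
  using regular regularCard_stable by (auto simp: regular_cardinal_def cinfinite_def)

lemma small_UN: "|A| <o \<tau> \<Longrightarrow> (\<And>a. a \<in> A \<Longrightarrow> |F a| <o \<tau>) \<Longrightarrow> |\<Union>a\<in>A. F a| <o \<tau>"
  using stable_UNION[OF stable] by blast

lemma small_Sigma: "|A| <o \<tau> \<Longrightarrow> (\<And>a. a \<in> A \<Longrightarrow> |F a| <o \<tau>) \<Longrightarrow> |Sigma A F| <o \<tau>"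
  using stable_elim[OF stable] by blast

lemma small_image: "|A| <o \<tau> \<Longrightarrow> |f ` A| <o \<tau>"
  using card_of_image ordLeq_ordLess_trans by blast

lemma small_subset: "|A| <o \<tau> \<Longrightarrow> B \<subseteq> A \<Longrightarrow> |B| <o \<tau>"
  using card_of_mono1 ordLeq_ordLess_trans by blast

lemma small_Un: "|A| <o \<tau> \<Longrightarrow> |B| <o \<tau> \<Longrightarrow> |A \<union> B| <o \<tau>"
  using Un_Cinfinite_bound_strict Cinfinite by blast

lemma small_finite: "finite A \<Longrightarrow> |A| <o \<tau>"
  using finite_ordLess_Cinfinite Cinfinite by blast

lemma small_nat: "|A :: nat set| <o \<tau>"
  using card_of_mono1[of A UNIV] card_of_nat uncountable
  by (metis ordLeq_ordIso_trans ordLeq_ordLess_trans top_greatest)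

text \<open>The finite subsets form a countable union of small families, one for each bound on the
  number of elements. Uncountability of \<open>\<tau>\<close> makes the index set of this union
  small.\<close>

lemma small_Fpow:
  assumes "|A| <o \<tau>"
  shows "|Fpow A| <o \<tau>"
proof -
  \<comment> \<open>\<open>F n\<close> arises by \<open>n\<close> insertions, repetitions allowed,
    so its members have at most \<open>n\<close> elements.\<close>
  define F where "F = rec_nat {{}} (\<lambda>_ S. (\<lambda>(a, X). insert a X) ` (A \<times> S))"
  have F0: "F 0 = {{}}" and FS: "\<And>n. F (Suc n) = (\<lambda>(a, X). insert a X) ` (A \<times> F n)"
    by (simp_all add: F_def)
  have "|F n| <o \<tau>" for n
    by (induction n) (use assms in \<open>simp_all add: F0 FS small_image small_Sigma small_finite\<close>)
  then have "|\<Union>n\<in>UNIV. F n| <o \<tau>"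
    by (intro small_UN small_nat)
  moreover have "Fpow A \<subseteq> (\<Union>n\<in>UNIV. F n)"
  proof
    fix X assume "X \<in> Fpow A"
    then have "finite X" "X \<subseteq> A"
      by (auto simp: Fpow_def)
    then show "X \<in> (\<Union>n\<in>UNIV. F n)"
    proof (induction rule: finite_induct)
      case empty
      then show ?case using F0 by blast
    next
      case (insert a X)
      then obtain n where "X \<in> F n" "a \<in> A" by auto
      then have "insert a X \<in> F (Suc n)" by (auto simp: FS)
      then show ?case by blast
    qed
  qed
  ultimately show ?thesis
    using small_subset by blast
qed

end

subsection \<open>Images of products and rich boxes\<close>

locale product_image =
  fixes Xs :: "'i \<Rightarrow> 'a topology" and I :: "'i set"
    and X :: "'b topology" and h :: "('i \<Rightarrow> 'a) \<Rightarrow> 'b"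
    and Bs :: "'i \<Rightarrow> 'a set set"
  assumes factors: "\<And>i. i \<in> I \<Longrightarrow> compactum (Xs i)"
    and image: "compactum X"
    and continuous: "continuous_map (product_topology Xs I) X h"
    and onto: "h ` topspace (product_topology Xs I) = topspace X"
    and bases: "\<And>i. i \<in> I \<Longrightarrow> is_base (Xs i) (Bs i)"
begin

abbreviation Y :: "('i \<Rightarrow> 'a) topology" where
  "Y \<equiv> product_topology Xs I"

definition box :: "('i \<times> 'a set) set \<Rightarrow> ('i \<Rightarrow> 'a) set" where
  "box c = {y \<in> topspace Y. \<forall>(i, b) \<in> c. y i \<in> b}"

text \<open>A code over \<open>J\<close> is a finite set of constraints \<open>y i \<in> b\<close>; its \<open>Domain\<close> is the set of
  coordinates it mentions, and unions of codes are intersections of boxes.\<close>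
definition codes :: "'i set \<Rightarrow> ('i \<times> 'a set) set set" where
  "codes J = Fpow (Sigma J Bs)"

abbreviation restrict_code :: "('i \<times> 'a set) set \<Rightarrow> 'i set \<Rightarrow> ('i \<times> 'a set) set" where
  "restrict_code c J \<equiv> c \<inter> J \<times> UNIV"

definition rich :: "('i \<times> 'a set) set \<Rightarrow> bool" where
  "rich c \<longleftrightarrow> X interior_of (X closure_of (h ` box c)) \<noteq> {}"

lemma compactum_Y: "compact_space Y" "Hausdorff_space Y"
  using factors by (auto simp: compact_space_product_topology Hausdorff_space_product_topology compactum_def)

lemma codes_mono: "J \<subseteq> K \<Longrightarrow> codes J \<subseteq> codes K"
  by (auto simp: codes_def Fpow_def)

lemma codes_finite: "c \<in> codes J \<Longrightarrow> finite c"
  by (simp add: codes_def Fpow_def)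

lemma codes_Domain: "c \<in> codes J \<Longrightarrow> Domain c \<subseteq> J"
  by (auto simp: codes_def Fpow_def)

lemma codes_finite_Domain: "c \<in> codes J \<Longrightarrow> finite (Domain c)"
  by (simp add: codes_finite finite_Domain)

lemma codes_Un: "c \<in> codes J \<Longrightarrow> d \<in> codes J \<Longrightarrow> c \<union> d \<in> codes J"
  by (auto simp: codes_def Fpow_def)

lemma codes_restrict: "c \<in> codes K \<Longrightarrow> restrict_code c J \<in> codes (J \<inter> K)"
  by (auto simp: codes_def Fpow_def)

lemma codes_subset: "c \<in> codes J \<Longrightarrow> d \<subseteq> c \<Longrightarrow> d \<in> codes J"
  by (auto simp: codes_def Fpow_def intro: finite_subset)

lemma codes_Diff: "c \<in> codes J \<Longrightarrow> c - d \<in> codes J"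
  by (rule codes_subset) auto

lemma box_Un: "box (c \<union> d) = box c \<inter> box d"
  by (auto simp: box_def)

lemma box_antimono: "c \<subseteq> d \<Longrightarrow> box d \<subseteq> box c"
  by (auto simp: box_def)

lemma box_topspace: "box c \<subseteq> topspace Y"
  by (auto simp: box_def)

lemma box_cong: "y \<in> box c \<Longrightarrow> z \<in> topspace Y \<Longrightarrow> (\<And>i. i \<in> Domain c \<Longrightarrow> z i = y i) \<Longrightarrow> z \<in> box c"
  by (fastforce simp: box_def)

lemma h_topspace: "y \<in> topspace Y \<Longrightarrow> h y \<in> topspace X"
  using onto by blast

lemma openin_box:
  assumes "c \<in> codes I"
  shows "openin Y (box c)"
proof -
  have "openin Y {y \<in> topspace Y. y i \<in> b}" if "(i, b) \<in> c" for i b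
  proof (rule openin_continuous_map_preimage)
    have ib: "i \<in> I" "b \<in> Bs i"
      using assms that by (auto simp: codes_def Fpow_def)
    then show "continuous_map Y (Xs i) (\<lambda>y. y i)"
      by (rule_tac continuous_map_product_projection)
    show "openin (Xs i) b"
      using ib bases is_base_openin by blast
  qed
  then have "openin Y ((\<Inter>p\<in>c. {y \<in> topspace Y. y (fst p) \<in> snd p}) \<inter> topspace Y)"
    by (intro openin_INT codes_finite[OF assms]) simp
  moreover have "box c = (\<Inter>p\<in>c. {y \<in> topspace Y. y (fst p) \<in> snd p}) \<inter> topspace Y"
    unfolding box_def by (rule set_eqI) (simp add: split_beta, metis)
  ultimately show ?thesis
    by simp
qed

lemma box_nbhd:
  assumes "openin Y U" "y \<in> U"
  obtains c where "c \<in> codes I" "y \<in> box c" "box c \<subseteq> U"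
proof -
  obtain V where V: "finite {i \<in> I. V i \<noteq> topspace (Xs i)}" "\<forall>i\<in>I. openin (Xs i) (V i)"
    "y \<in> Pi\<^sub>E I V" "Pi\<^sub>E I V \<subseteq> U"
    using assms unfolding openin_product_topology_alt by meson
  let ?S = "{i \<in> I. V i \<noteq> topspace (Xs i)}"
  have "\<forall>i\<in>?S. \<exists>b. b \<in> Bs i \<and> y i \<in> b \<and> b \<subseteq> V i"
  proof
    fix i assume i: "i \<in> ?S"
    then have "openin (Xs i) (V i)" "y i \<in> V i" "i \<in> I"
      using V by auto
    then show "\<exists>b. b \<in> Bs i \<and> y i \<in> b \<and> b \<subseteq> V i"
      using is_base_nbhd[OF bases] by metis
  qed
  then obtain b where b: "\<And>i. i \<in> ?S \<Longrightarrow> b i \<in> Bs i \<and> y i \<in> b i \<and> b i \<subseteq> V i"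
    by metis
  let ?c = "(\<lambda>i. (i, b i)) ` ?S"
  have yt: "y \<in> topspace Y"
    using assms openin_subset by blast
  have "?c \<in> codes I"
    using V(1) b by (auto simp: codes_def Fpow_def)
  moreover have "y \<in> box ?c"
    using b yt unfolding box_def by fast
  moreover have "box ?c \<subseteq> U"
  proof (rule subset_trans[OF _ V(4)], rule)
    fix z assume "z \<in> box ?c"
    then have zt: "z \<in> topspace Y" and zb: "\<And>i. i \<in> ?S \<Longrightarrow> z i \<in> b i"
      unfolding box_def by auto
    have "z i \<in> V i" if "i \<in> I" for i
    proof (cases "i \<in> ?S")
      case True
      then show ?thesis using zb b by blast
    next
      case False
      then show ?thesis using zt that by (auto simp: PiE_def)
    qed
    then show "z \<in> Pi\<^sub>E I V"
      using zt by (simp add: PiE_def Pi_def)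
  qed
  ultimately show thesis
    by (rule that)
qed

lemma box_preimage_nbhd:
  assumes "openin X U" "y \<in> topspace Y" "h y \<in> U"
  obtains c where "c \<in> codes I" "y \<in> box c" "h ` box c \<subseteq> U"
proof (rule box_nbhd)
  show "openin Y {y \<in> topspace Y. h y \<in> U}"
    by (rule openin_continuous_map_preimage[OF continuous assms(1)])
  show "y \<in> {y \<in> topspace Y. h y \<in> U}"
    using assms by simp
  fix c assume "c \<in> codes I" "y \<in> box c" "box c \<subseteq> {y \<in> topspace Y. h y \<in> U}"
  then show thesis
    by (intro that) auto
qed

text \<open>This is where the product structure enters: requirements on disjoint sets of coordinates
  are compatible, even infinitely many of them, and the other coordinates can be prescribed by
  \<open>y\<close>.\<close>

lemma box_glue:
  assumes y: "y \<in> topspace Y"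
    and P: "\<And>c. c \<in> P \<Longrightarrow> box c \<noteq> {}"
    and disj: "\<And>c d. c \<in> P \<Longrightarrow> d \<in> P \<Longrightarrow> c \<noteq> d \<Longrightarrow> Domain c \<inter> Domain d = {}"
  shows "\<exists>z\<in>topspace Y. (\<forall>c\<in>P. z \<in> box c) \<and> (\<forall>i. i \<notin> \<Union>(Domain ` P) \<longrightarrow> z i = y i)"
proof -
  have "\<forall>c\<in>P. \<exists>y. y \<in> box c"
    using P by blast
  from bchoice[OF this] obtain w where w: "\<forall>c\<in>P. w c \<in> box c" ..
  \<comment> \<open>Disjointness of the domains makes the \<open>THE\<close> unique. All values come
    from points of \<open>Y\<close>, so \<open>z\<close> lies in \<open>Y\<close>.\<close>
  define z where "z i = (if \<exists>c\<in>P. i \<in> Domain c then w (THE c. c \<in> P \<and> i \<in> Domain c) i else y i)" for i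
  have zc: "z i = w c i" if "c \<in> P" "i \<in> Domain c" for c i
  proof -
    have "(THE c. c \<in> P \<and> i \<in> Domain c) = c"
    proof (rule the_equality)
      show "d = c" if "d \<in> P \<and> i \<in> Domain d" for d
        using disj[of c d] that \<open>c \<in> P\<close> \<open>i \<in> Domain c\<close> by (metis IntI empty_iff)
    qed (use that in simp)
    then show ?thesis
      using that by (auto simp: z_def)
  qed
  have zn: "z i = y i" if "i \<notin> \<Union>(Domain ` P)" for i
    using that by (auto simp: z_def)
  have wt: "w c \<in> topspace Y" if "c \<in> P" for c
    using w that box_topspace by blast
  have z: "z \<in> topspace Y"
  proof -
    have "z i \<in> topspace (Xs i) \<and> i \<in> I \<or> z i = undefined \<and> i \<notin> I" for i
    proof (cases "i \<in> \<Union>(Domain ` P)")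
      case True
      then obtain c where c: "c \<in> P" "i \<in> Domain c" by blast
      then show ?thesis
        using zc[OF c] wt[OF c(1)] by (auto simp: PiE_iff extensional_def)
    next
      case False
      then show ?thesis
        using zn[OF False] y by (auto simp: PiE_iff extensional_def)
    qed
    then show ?thesis
      by (force simp: PiE_iff extensional_def)
  qed
  have "z \<in> box c" if "c \<in> P" for c
    by (rule box_cong[OF bspec[OF w that] z zc[OF that]])
  then show ?thesis
    using z zn by blast
qed

lemma box_Int_nonempty:
  assumes "box c \<noteq> {}" "box d \<noteq> {}" "Domain c \<inter> Domain d = {}"
  shows "box c \<inter> box d \<noteq> {}"
proof -
  obtain y where y: "y \<in> box c"
    using assms(1) by blast
  have "y \<in> topspace Y"
    using y box_topspace by blast
  then obtain z where z: "z \<in> topspace Y" "z \<in> box d" "\<And>i. i \<notin> Domain d \<Longrightarrow> z i = y i"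
    using box_glue[of y "{d}"] assms(2) by auto
  have "z \<in> box c"
    using box_cong[OF y z(1)] z(3) assms(3) by blast
  then show ?thesis
    using z(2) by blast
qed

text \<open>What remains of the product after removing every box with nowhere dense image. All boxes
  around such a point are rich.\<close>

definition rich_points :: "('i \<Rightarrow> 'a) set" where
  "rich_points = {y \<in> topspace Y. \<forall>c\<in>codes I. y \<in> box c \<longrightarrow> rich c}"

lemma rich_antimono: "rich c \<Longrightarrow> d \<subseteq> c \<Longrightarrow> rich d"
  unfolding rich_def
  by (metis box_antimono closure_of_mono image_mono interior_of_mono subset_empty)

lemma rich_nonempty: "rich c \<Longrightarrow> box c \<noteq> {}"
  by (auto simp: rich_def)

lemma compactin_box_cover:
  assumes K: "compactin Y K" and cover: "\<And>y. y \<in> K \<Longrightarrow> \<exists>c\<in>codes I. P c \<and> y \<in> box c"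
  shows "\<exists>D. finite D \<and> D \<subseteq> {c \<in> codes I. P c} \<and> K \<subseteq> \<Union>(box ` D)"
proof -
  let ?C = "{c \<in> codes I. P c}"
  have "K \<subseteq> \<Union>(box ` ?C)"
    using cover by blast
  moreover have "\<forall>U \<in> box ` ?C. openin Y U"
    using openin_box by auto
  ultimately obtain \<F> where "finite \<F>" "\<F> \<subseteq> box ` ?C" "K \<subseteq> \<Union>\<F>"
    using K unfolding compactin_def by meson
  moreover then obtain D where "finite D" "D \<subseteq> ?C" "\<F> = box ` D"
    by (meson finite_subset_image)
  ultimately show ?thesis
    by auto
qed

lemma closedin_preimage: "closedin X K \<Longrightarrow> closedin Y {y \<in> topspace Y. h y \<in> K}"
  using continuous closedin_continuous_map_preimage by blast

lemma closedin_image: "closedin Y K \<Longrightarrow> closedin X (h ` K)"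
  using continuous_imp_closed_map[OF continuous compactum_Y(1)] image
  by (auto simp: compactum_def closed_map_def)

lemma closedin_rich_points: "closedin Y rich_points"
proof -
  have "topspace Y - rich_points = \<Union>(box ` {c \<in> codes I. \<not> rich c})"
    using box_topspace by (auto simp: rich_points_def)
  moreover have "openin Y (\<Union>(box ` {c \<in> codes I. \<not> rich c}))"
    using openin_box by blast
  ultimately show ?thesis
    by (auto simp: closedin_def rich_points_def)
qed

text \<open>Otherwise a fibre, hence the preimage of a neighbourhood, would be covered by finitely many
  boxes with nowhere dense images.\<close>
lemma rich_points_onto: "h ` rich_points = topspace X"
proof
  show "h ` rich_points \<subseteq> topspace X"
    using h_topspace by (auto simp: rich_points_def)
next
  show "topspace X \<subseteq> h ` rich_points"
  proof (rule ccontr)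
    assume "\<not> ?thesis"
    then obtain p where p: "p \<in> topspace X" "p \<notin> h ` rich_points" by blast
    let ?K = "{y \<in> topspace Y. h y \<in> {p}}"
    have "closedin X {p}"
      using p image by (simp add: compactum_def closedin_Hausdorff_singleton)
    then have K: "compactin Y ?K"
      using closedin_preimage closedin_compact_space compactum_Y(1) by blast
    have "\<exists>c\<in>codes I. \<not> rich c \<and> y \<in> box c" if "y \<in> ?K" for y
      using that p(2) by (auto simp: rich_points_def)
    then obtain D where D: "finite D" "D \<subseteq> {c \<in> codes I. \<not> rich c}" "?K \<subseteq> \<Union>(box ` D)"
      using compactin_box_cover[OF K, of "\<lambda>c. \<not> rich c"] by meson
    \<comment> \<open>\<open>?V\<close> consists of the points whose whole fibre lies in the boxes
      of \<open>D\<close>; it is open because \<open>h\<close> is a closed map.\<close>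
    let ?V = "topspace X - h ` (topspace Y - \<Union>(box ` D))"
    have "openin Y (\<Union>(box ` D))"
      using D(2) openin_box by blast
    then have "closedin Y (topspace Y - \<Union>(box ` D))"
      by blast
    then have V: "openin X ?V"
      using closedin_image by blast
    have "p \<in> ?V"
      using D(3) p(1) by auto
    have sub: "?V \<subseteq> \<Union>((\<lambda>c. X closure_of (h ` box c)) ` D)"
    proof
      fix q assume q: "q \<in> ?V"
      then obtain y where "y \<in> topspace Y" "q = h y"
        using onto by blast
      then obtain c where "c \<in> D" "q \<in> h ` box c"
        using q by blast
      moreover have "h ` box c \<subseteq> X closure_of (h ` box c)"
        by (rule closure_of_subset) (use box_topspace h_topspace in blast)
      ultimately show "q \<in> \<Union>((\<lambda>c. X closure_of (h ` box c)) ` D)"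
        by blast
    qed
    have "X interior_of \<Union>((\<lambda>c. X closure_of (h ` box c)) ` D) = {}"
      using D(1,2) by (intro interior_of_Union_closedin_eq_empty) (auto simp: rich_def)
    then show False
      using interior_of_maximal[OF sub V] \<open>p \<in> ?V\<close> by blast
  qed
qed

text \<open>Since the rich points still map onto \<open>X\<close>, some rich point lands in
  \<open>U\<close>; any box around it that is mapped into \<open>U\<close> is rich.\<close>

lemma rich_dense:
  assumes "openin X U" "U \<noteq> {}"
  obtains c where "c \<in> codes I" "rich c" "h ` box c \<subseteq> U"
proof -
  have "U \<subseteq> h ` rich_points"
    using assms(1) openin_subset by (simp add: rich_points_onto)
  then obtain y where y: "y \<in> rich_points" "h y \<in> U"
    using assms(2) by auto
  then have yt: "y \<in> topspace Y"
    by (simp add: rich_points_def)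
  obtain c where "c \<in> codes I" "y \<in> box c" "h ` box c \<subseteq> U"
    by (rule box_preimage_nbhd[OF assms(1) yt y(2)])
  moreover then have "rich c"
    using y(1) by (simp add: rich_points_def)
  ultimately show thesis
    by (intro that)
qed

text \<open>If \<open>h\<close> restricted to the rich points factors through the projection to \<open>J\<close>, then boxes over
  \<open>J\<close> suffice to describe the topology of \<open>X\<close>.\<close>
lemma base_of_factorization:
  assumes J: "J \<subseteq> I"
    and factor: "\<And>y z. y \<in> rich_points \<Longrightarrow> z \<in> rich_points \<Longrightarrow> (\<And>i. i \<in> J \<Longrightarrow> y i = z i) \<Longrightarrow> h y = h z"
  shows "is_base X ((\<lambda>D. topspace X - h ` (rich_points - \<Union>(box ` D))) ` Fpow (codes J))"
    (is "is_base X (?N ` _)")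
  unfolding is_base_iff
proof (intro conjI ballI allI impI)
  fix V assume "V \<in> ?N ` Fpow (codes J)"
  then obtain D where D: "D \<subseteq> codes J" "V = ?N D"
    by (auto simp: Fpow_def)
  have "openin Y (\<Union>(box ` D))"
    using D(1) J codes_mono openin_box by blast
  then have "closedin Y (rich_points - \<Union>(box ` D))"
    using closedin_rich_points by blast
  then show "openin X V"
    unfolding D(2) using closedin_image by blast
next
  fix U p assume "openin X U \<and> p \<in> U"
  then have U: "openin X U" "p \<in> U" by auto
  have pX: "p \<in> topspace X"
    using U openin_subset by blast
  let ?K = "rich_points \<inter> {y \<in> topspace Y. h y \<in> {p}}"
  let ?L = "rich_points \<inter> {y \<in> topspace Y. h y \<in> topspace X - U}"
  have "closedin X {p}"
    using pX image by (simp add: compactum_def closedin_Hausdorff_singleton)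
  then have K: "compactin Y ?K"
    by (intro closedin_compact_space compactum_Y closedin_Int closedin_rich_points closedin_preimage)
  have "closedin X (topspace X - U)"
    using U(1) by blast
  then have L: "compactin Y ?L"
    by (intro closedin_compact_space compactum_Y closedin_Int closedin_rich_points closedin_preimage)
  \<comment> \<open>Compactness is used twice, as in separating disjoint compact sets: first one
    point \<open>y\<close> from all of \<open>?L\<close>, then, through \<open>D\<close>, all of
    \<open>?K\<close> from \<open>?L\<close>. Only the boxes on the side of \<open>?K\<close> must
    be coded over \<open>J\<close>.\<close>
  have sep: "\<exists>c\<in>codes I. (c \<in> codes J \<and> box c \<inter> ?L = {}) \<and> y \<in> box c" if y: "y \<in> ?K" for y
  proof -
    have "\<exists>e\<in>codes I. (\<exists>d\<in>codes J. y \<in> box d \<and> box d \<inter> box e = {}) \<and> z \<in> box e" if z: "z \<in> ?L" for z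
    proof -
      have "h y \<noteq> h z"
        using y z U(2) by auto
      then obtain i where i: "i \<in> J" "y i \<noteq> z i"
        using factor[of y z] y z by blast
      have iI: "i \<in> I"
        using i J by blast
      have "y i \<in> topspace (Xs i)" "z i \<in> topspace (Xs i)"
        using y z iI by auto
      then obtain A B where AB: "openin (Xs i) A" "openin (Xs i) B" "y i \<in> A" "z i \<in> B" "disjnt A B"
        using factors[OF iI] i(2) unfolding compactum_def Hausdorff_space_def by metis
      obtain a where a: "a \<in> Bs i" "y i \<in> a" "a \<subseteq> A"
        by (rule is_base_nbhd[OF bases[OF iI] AB(1,3)])
      obtain b where b: "b \<in> Bs i" "z i \<in> b" "b \<subseteq> B"
        by (rule is_base_nbhd[OF bases[OF iI] AB(2,4)])
      have "{(i, a)} \<in> codes J" "{(i, b)} \<in> codes I" "y \<in> box {(i, a)}" "z \<in> box {(i, b)}"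
        "box {(i, a)} \<inter> box {(i, b)} = {}"
        using a b i(1) iI y z AB(5) by (auto simp: codes_def Fpow_def box_def disjnt_def)
      then show ?thesis by blast
    qed
    then obtain E where E: "finite E"
      "E \<subseteq> {e \<in> codes I. \<exists>d\<in>codes J. y \<in> box d \<and> box d \<inter> box e = {}}" "?L \<subseteq> \<Union>(box ` E)"
      using compactin_box_cover[OF L, of "\<lambda>e. \<exists>d\<in>codes J. y \<in> box d \<and> box d \<inter> box e = {}"]
      by meson
    then have "\<forall>e\<in>E. \<exists>d. d \<in> codes J \<and> y \<in> box d \<and> box d \<inter> box e = {}"
      by blast
    then obtain d where d: "\<And>e. e \<in> E \<Longrightarrow> d e \<in> codes J \<and> y \<in> box (d e) \<and> box (d e) \<inter> box e = {}"
      by metis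
    let ?c = "\<Union>(d ` E)"
    have "?c \<in> codes J"
      using d E(1) by (auto simp: codes_def Fpow_def)
    moreover have "y \<in> box ?c"
      using d y by (fastforce simp: box_def)
    moreover have "box ?c \<inter> ?L = {}"
    proof -
      have "box ?c \<inter> box e = {}" if "e \<in> E" for e
        using d[OF that] box_antimono[of "d e" ?c] that by blast
      then show ?thesis using E(3) by blast
    qed
    ultimately show ?thesis
      using codes_mono[OF J] by blast
  qed
  obtain D where D: "finite D" "D \<subseteq> {c \<in> codes I. c \<in> codes J \<and> box c \<inter> ?L = {}}" "?K \<subseteq> \<Union>(box ` D)"
    using compactin_box_cover[OF K, of "\<lambda>c. c \<in> codes J \<and> box c \<inter> ?L = {}"] sep by meson
  have "D \<in> Fpow (codes J)"
    using D by (auto simp: Fpow_def)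
  moreover have "p \<in> ?N D"
    using D(3) pX by (auto simp: rich_points_def)
  moreover have "?N D \<subseteq> U"
  proof
    fix q assume q: "q \<in> ?N D"
    then obtain z where z: "z \<in> rich_points" "q = h z"
      using rich_points_onto by blast
    then obtain c where "c \<in> D" "z \<in> box c"
      using q by blast
    then have "z \<notin> ?L"
      using D(2) by blast
    then show "q \<in> U"
      using z q by (auto simp: rich_points_def)
  qed
  ultimately show "\<exists>V\<in>?N ` Fpow (codes J). p \<in> V \<and> V \<subseteq> U"
    by blast
qed

subsection \<open>Points of large \<open>\<pi>\<close>-character\<close>

definition splits :: "('i \<times> 'a set) set \<Rightarrow> ('i \<times> 'a set) set \<Rightarrow> ('i \<times> 'a set) set \<Rightarrow> bool" where
  "splits r c d \<longleftrightarrow> (\<exists>V W. openin X V \<and> openin X W \<and> V \<inter> W = {} \<and>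
     h ` box (r \<union> c) \<subseteq> V \<and> h ` box (r \<union> d) \<subseteq> W)"

abbreviation pair_domain :: "('i \<times> 'a set) set \<times> ('i \<times> 'a set) set \<Rightarrow> 'i set" where
  "pair_domain q \<equiv> Domain (fst q) \<union> Domain (snd q)"

text \<open>By disjointness of coordinates the choices between \<open>c\<close> and \<open>d\<close> can be made independently for
  all pairs \<open>(c, d)\<close> of a splitting.\<close>
definition splitting :: "('i \<times> 'a set) set \<Rightarrow> (('i \<times> 'a set) set \<times> ('i \<times> 'a set) set) set \<Rightarrow> bool" where
  "splitting r S \<longleftrightarrow>
     (\<forall>q\<in>S. fst q \<in> codes I \<and> snd q \<in> codes I \<and> box (fst q) \<noteq> {} \<and> box (snd q) \<noteq> {} \<and>
        splits r (fst q) (snd q) \<and> pair_domain q \<inter> Domain r = {}) \<and>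
     pairwise (\<lambda>q q'. pair_domain q \<inter> pair_domain q' = {}) S"

text \<open>Zorn's lemma applies because each condition on a splitting concerns at most two of its
  pairs, and so passes to unions of chains.\<close>

lemma ex_maximal_splitting:
  "\<exists>S. splitting r S \<and> (\<forall>S'. splitting r S' \<and> S \<subseteq> S' \<longrightarrow> S' = S)"
proof -
  have "\<exists>M\<in>Collect (splitting r). \<forall>S\<in>Collect (splitting r). M \<subseteq> S \<longrightarrow> S = M"
  proof (rule subset_Zorn')
    fix C assume "subset.chain (Collect (splitting r)) C"
    then have C: "\<And>S. S \<in> C \<Longrightarrow> splitting r S" "\<And>S S'. S \<in> C \<Longrightarrow> S' \<in> C \<Longrightarrow> S \<subseteq> S' \<or> S' \<subseteq> S"
      by (auto simp: subset_chain_def)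
    have "pairwise (\<lambda>q q'. pair_domain q \<inter> pair_domain q' = {}) (\<Union>C)"
      unfolding pairwise_def
    proof (intro ballI impI)
      fix q q' assume "q \<in> \<Union>C" "q' \<in> \<Union>C" and ne: "q \<noteq> q'"
      then obtain S where "S \<in> C" "q \<in> S" "q' \<in> S"
        using C(2) by blast
      then show "pair_domain q \<inter> pair_domain q' = {}"
        using C(1) ne unfolding splitting_def pairwise_def by blast
    qed
    then show "\<Union>C \<in> Collect (splitting r)"
      using C(1) unfolding splitting_def by blast
  qed
  then show ?thesis by auto
qed

end

locale small_product_image = product_image + uncountable_regular +
  assumes small_bases: "\<And>i. i \<in> I \<Longrightarrow> |Bs i| <o \<tau>"
begin

lemma small_codes:
  assumes "J \<subseteq> I" "|J| <o \<tau>"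
  shows "|codes J| <o \<tau>"
  unfolding codes_def using assms small_bases by (intro small_Fpow small_Sigma) auto

text \<open>Members need not contain \<open>p\<close>; when no such family exists, \<open>p\<close>
  has \<pi>-character at least \<open>\<tau>\<close>.\<close>

definition small_local_pi_base :: "'c \<Rightarrow> 'c set set \<Rightarrow> bool" where
  "small_local_pi_base p \<U> \<longleftrightarrow> |\<U>| <o \<tau> \<and> (\<forall>U\<in>\<U>. openin X U \<and> U \<noteq> {}) \<and>
     (\<forall>V. openin X V \<and> p \<in> V \<longrightarrow> (\<exists>U\<in>\<U>. U \<subseteq> V))"

text \<open>Otherwise \<open>h\<close> on the rich points factors through the coordinates in
  \<open>J\<close>, and the base indexed by finite sets of codes over \<open>J\<close> has size
  below \<open>\<tau>\<close>.\<close>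

lemma ex_separated_rich_points:
  assumes "\<not> weight X <o \<tau>" "J \<subseteq> I" "|J| <o \<tau>"
  obtains y z where "y \<in> rich_points" "z \<in> rich_points" "\<And>i. i \<in> J \<Longrightarrow> y i = z i" "h y \<noteq> h z"
proof (rule ccontr)
  assume no: "\<not> thesis"
  have "is_base X ((\<lambda>D. topspace X - h ` (rich_points - \<Union>(box ` D))) ` Fpow (codes J))"
    by (rule base_of_factorization) (use no that assms(2) in blast)+
  moreover have "|(\<lambda>D. topspace X - h ` (rich_points - \<Union>(box ` D))) ` Fpow (codes J)| <o \<tau>"
    using assms small_codes by (intro small_image small_Fpow) auto
  ultimately show False
    using weight_less_base uncountable Cinfinite assms(1) by blast
qed

text \<open>Otherwise, closing off under the coordinates of maximal splittings yields a small \<open>J\<close>; two rich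
  points that agree on \<open>J\<close> but have distinct images then extend one of these splittings.\<close>
lemma ex_large_splitting:
  assumes large: "\<not> weight X <o \<tau>"
  shows "\<exists>r S. r \<in> codes I \<and> rich r \<and> splitting r S \<and> \<not> |S| <o \<tau>"
proof (rule ccontr)
  assume no: "\<not> ?thesis"
  obtain S where S: "\<And>r. splitting r (S r)" "\<And>r S'. splitting r S' \<Longrightarrow> S r \<subseteq> S' \<Longrightarrow> S' = S r"
    using ex_maximal_splitting by metis
  have smallS: "|S r| <o \<tau>" if "r \<in> codes I" "rich r" for r
    using no that S(1) by blast
  define supp where "supp r = (\<Union>q\<in>S r. pair_domain q)" for r
  have supp_I: "supp r \<subseteq> I" for r
    using S(1)[of r] codes_Domain unfolding supp_def splitting_def by blast
  have supp_small: "|supp r| <o \<tau>" if "r \<in> codes I" "rich r" for r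
    unfolding supp_def
  proof (rule small_UN[OF smallS[OF that]])
    fix q assume "q \<in> S r"
    then have "finite (pair_domain q)"
      using S(1)[of r] codes_finite_Domain unfolding splitting_def by blast
    then show "|pair_domain q| <o \<tau>"
      by (rule small_finite)
  qed
  \<comment> \<open>Countably many rounds close \<open>J\<close> under \<open>supp\<close> for rich
    codes, since a code over the union has a finite domain and so appears at some stage. The union
    stays small as \<open>\<tau>\<close> is regular and uncountable.\<close>
  define Js where "Js = rec_nat {} (\<lambda>_ J. J \<union> (\<Union>r\<in>codes J \<inter> Collect rich. supp r))"
  have Js0: "Js 0 = {}" and JsS: "\<And>n. Js (Suc n) = Js n \<union> (\<Union>r\<in>codes (Js n) \<inter> Collect rich. supp r)"
    by (simp_all add: Js_def)
  have Js_I: "Js n \<subseteq> I" for n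
    by (induction n) (use supp_I in \<open>auto simp: Js0 JsS\<close>)
  have Js_small: "|Js n| <o \<tau>" for n
  proof (induction n)
    case 0
    then show ?case by (simp add: Js0 small_finite)
  next
    case (Suc n)
    have "|codes (Js n) \<inter> Collect rich| <o \<tau>"
      using small_codes[OF Js_I Suc] small_subset by blast
    moreover have "codes (Js n) \<subseteq> codes I"
      by (rule codes_mono[OF Js_I])
    ultimately show ?case
      unfolding JsS using Suc supp_small by (intro small_Un small_UN) auto
  qed
  have Js_mono: "Js m \<subseteq> Js n" if "m \<le> n" for m n
    using that by (rule lift_Suc_mono_le[rotated]) (simp add: JsS)
  define J where "J = (\<Union>n. Js n)"
  have J: "J \<subseteq> I" "|J| <o \<tau>"
    unfolding J_def using Js_I by (auto intro!: small_UN small_nat Js_small)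
  obtain y z where yz: "y \<in> rich_points" "z \<in> rich_points" "\<And>i. i \<in> J \<Longrightarrow> y i = z i" "h y \<noteq> h z"
    by (rule ex_separated_rich_points[OF large J]) blast
  have yzt: "y \<in> topspace Y" "z \<in> topspace Y"
    using yz by (auto simp: rich_points_def)
  then obtain V W where VW: "openin X V" "openin X W" "h y \<in> V" "h z \<in> W" "V \<inter> W = {}"
    using image yz(4) h_topspace unfolding compactum_def Hausdorff_space_def disjnt_def by metis
  obtain c0 where c0: "c0 \<in> codes I" "y \<in> box c0" "h ` box c0 \<subseteq> V"
    by (rule box_preimage_nbhd[OF VW(1) yzt(1) VW(3)])
  obtain d0 where d0: "d0 \<in> codes I" "z \<in> box d0" "h ` box d0 \<subseteq> W"
    by (rule box_preimage_nbhd[OF VW(2) yzt(2) VW(4)])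
  \<comment> \<open>All constraints of \<open>c0\<close> and \<open>d0\<close> at coordinates in
    \<open>J\<close> go into \<open>r\<close>. As \<open>y\<close> and \<open>z\<close> agree on
    \<open>J\<close>, \<open>y\<close> satisfies those of \<open>d0\<close> as well;
    \<open>c\<close> and \<open>d\<close> carry the rest.\<close>
  define r where "r = restrict_code (c0 \<union> d0) J"
  define c where "c = c0 - J \<times> UNIV"
  define d where "d = d0 - J \<times> UNIV"
  have rJ: "r \<in> codes J"
    using codes_restrict[OF codes_Un[OF c0(1) d0(1)], of J] J(1) by (simp add: r_def Int_absorb2)
  have cd: "c \<in> codes I" "d \<in> codes I"
    using c0(1) d0(1) by (auto simp: c_def d_def intro: codes_Diff)
  have "y \<in> box (restrict_code d0 J)"
  proof (rule box_cong[OF _ yzt(1)])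
    show "z \<in> box (restrict_code d0 J)"
      using d0(2) box_antimono by blast
  qed (use yz(3) in auto)
  moreover have "y \<in> box (restrict_code c0 J)"
    using c0(2) box_antimono by blast
  moreover have "r = restrict_code c0 J \<union> restrict_code d0 J"
    by (auto simp: r_def)
  ultimately have yr: "y \<in> box r"
    by (simp add: box_Un)
  have rI: "r \<in> codes I"
    using rJ J codes_mono by blast
  have rich: "rich r"
    using yz(1) yr rI by (auto simp: rich_points_def)
  obtain n where n: "r \<in> codes (Js n)"
  proof -
    have "finite (Domain r)" "Domain r \<subseteq> (\<Union>n. Js n)"
      using codes_finite_Domain[OF rJ] codes_Domain[OF rJ] by (simp_all add: J_def)
    then have "\<exists>n. Domain r \<subseteq> Js n"
    proof (induction rule: finite_induct)
      case (insert i F)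
      then obtain m n where "F \<subseteq> Js m" "i \<in> Js n" by blast
      then have "insert i F \<subseteq> Js (max m n)"
        using Js_mono[of m "max m n"] Js_mono[of n "max m n"] by auto
      then show ?case ..
    qed simp
    then obtain n where "Domain r \<subseteq> Js n" ..
    then have "r \<in> codes (Js n)"
      using rI by (auto simp: codes_def Fpow_def)
    then show thesis by (rule that)
  qed
  then have supp_J: "supp r \<subseteq> J"
    using rich JsS[of n] by (auto simp: J_def)
  have "splits r c d"
    unfolding splits_def
  proof (intro exI conjI)
    show "openin X V" "openin X W" "V \<inter> W = {}"
      using VW by auto
    have "box (r \<union> c) \<subseteq> box c0" "box (r \<union> d) \<subseteq> box d0"
      by (auto intro!: box_antimono simp: r_def c_def d_def)
    then show "h ` box (r \<union> c) \<subseteq> V" "h ` box (r \<union> d) \<subseteq> W"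
      using c0(3) d0(3) by (meson image_mono subset_trans)+
  qed
  moreover have "box c \<noteq> {}" "box d \<noteq> {}"
    using c0(2) d0(2) box_antimono[of c c0] box_antimono[of d d0] by (auto simp: c_def d_def)
  moreover have cdJ: "pair_domain (c, d) \<inter> J = {}"
    by (auto simp: c_def d_def)
  moreover have "Domain r \<subseteq> J"
    using rJ codes_Domain by blast
  moreover have "\<forall>q\<in>S r. pair_domain q \<subseteq> J"
    using supp_J by (auto simp: supp_def)
  ultimately have "splitting r (insert (c, d) (S r))"
    using S(1)[of r] cd unfolding splitting_def pairwise_insert ball_simps fst_conv snd_conv
    by (intro conjI ballI impI) blast+
  then have "(c, d) \<in> S r"
    using S(2)[of r "insert (c, d) (S r)"] by auto
  \<comment> \<open>By maximality the new pair is already present, so its coordinates lie both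
    inside and outside \<open>J\<close>. Both codes are then empty, and the nonempty box of
    \<open>r\<close> would map into two disjoint open sets.\<close>
  then have "pair_domain (c, d) \<subseteq> J"
    using supp_J unfolding supp_def by blast
  then have "pair_domain (c, d) = {}"
    using cdJ by blast
  then have "c = {}" "d = {}"
    by (auto simp: Domain_empty_iff)
  then obtain V' W' where "V' \<inter> W' = {}" "h ` box r \<subseteq> V'" "h ` box r \<subseteq> W'"
    using \<open>splits r c d\<close> unfolding splits_def by auto
  then show False
    using yr by blast
qed

text \<open>A point in the intersection of all boxes \<open>r \<union> c\<close> does the job: boxes witnessing a small local
  \<open>\<pi>\<close>-base miss the coordinates of some pair \<open>(c, d)\<close>, hence meet \<open>d\<close>, whose image is kept away from
  that point. Finitely many pairs are dropped so that the image lies in the interior of the closure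
  of the image of \<open>r\<close>, where the members of the \<open>\<pi>\<close>-base pull back to boxes inside \<open>r\<close>.\<close>
lemma large_splitting_no_small_local_pi_base:
  assumes r: "r \<in> codes I" "rich r" and S: "splitting r S" and large: "\<not> |S| <o \<tau>"
  shows "\<exists>p\<in>topspace X. \<forall>\<U>. \<not> small_local_pi_base p \<U>"
proof -
  define G where "G = X interior_of (X closure_of (h ` box r))"
  have G: "openin X G" "G \<noteq> {}" "G \<subseteq> X closure_of (h ` box r)"
    using r(2) by (auto simp: G_def rich_def interior_of_subset)
  have meets: "\<exists>y\<in>box r. h y \<in> U" if U: "openin X U" "U \<noteq> {}" "U \<subseteq> G" for U
  proof -
    obtain x where "x \<in> U" using U by blast
    then have "x \<in> X closure_of (h ` box r)"
      using U G by blast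
    then show ?thesis
      using U(1) \<open>x \<in> U\<close> unfolding in_closure_of by blast
  qed
  obtain y where y: "y \<in> box r" "h y \<in> G"
    using meets[OF G(1,2)] by blast
  have yt: "y \<in> topspace Y"
    using y box_topspace by blast
  obtain b where b: "b \<in> codes I" "y \<in> box b" "h ` box b \<subseteq> G"
    by (rule box_preimage_nbhd[OF G(1) yt y(2)])
  \<comment> \<open>For the remaining pairs the choice of \<open>z\<close> does not disturb
    \<open>b\<close>, which keeps \<open>h z\<close> in \<open>G\<close>.\<close>
  define S' where "S' = {q \<in> S. pair_domain q \<inter> Domain b = {}}"
  have Sq: "fst q \<in> codes I" "snd q \<in> codes I" "box (fst q) \<noteq> {}" "box (snd q) \<noteq> {}"
    "splits r (fst q) (snd q)" "pair_domain q \<inter> Domain r = {}" if "q \<in> S" for q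
    using S that unfolding splitting_def by blast+
  have disj: "pair_domain q \<inter> pair_domain q' = {}" if "q \<in> S" "q' \<in> S" "q \<noteq> q'" for q q'
    using S that unfolding splitting_def pairwise_def by blast
  have nonempty: "box c \<noteq> {}" if "c \<in> fst ` S'" for c
    using that Sq by (auto simp: S'_def)
  have disj': "Domain c \<inter> Domain d = {}" if "c \<in> fst ` S'" "d \<in> fst ` S'" "c \<noteq> d" for c d
    using that disj unfolding S'_def by blast
  \<comment> \<open>Take the first alternative of every remaining pair at once; the coordinates of
    \<open>b\<close> and \<open>r\<close> keep their values from \<open>y\<close>.\<close>
  have "\<exists>z\<in>topspace Y. (\<forall>c\<in>fst ` S'. z \<in> box c) \<and> (\<forall>i. i \<notin> \<Union>(Domain ` fst ` S') \<longrightarrow> z i = y i)"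
    by (rule box_glue[OF yt nonempty disj'])
  then obtain z where z: "z \<in> topspace Y" "\<forall>c\<in>fst ` S'. z \<in> box c"
    "\<forall>i. i \<notin> \<Union>(Domain ` fst ` S') \<longrightarrow> z i = y i"
    by (elim bexE conjE)
  have off: "i \<notin> \<Union>(Domain ` fst ` S')" if "i \<in> Domain b \<union> Domain r" for i
    using Sq(6) that unfolding S'_def by blast
  have zb: "z \<in> box b"
    by (rule box_cong[OF b(2) z(1)]) (use z(3) off in blast)
  have zr: "z \<in> box r"
    by (rule box_cong[OF y(1) z(1)]) (use z(3) off in blast)
  show ?thesis
  proof (intro bexI[of _ "h z"] allI)
    show "h z \<in> topspace X"
      using z(1) h_topspace by blast
    fix \<U> show "\<not> small_local_pi_base (h z) \<U>"
    proof
      assume U: "small_local_pi_base (h z) \<U>"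
      define \<V> where "\<V> = {U \<in> \<U>. U \<subseteq> G}"
      have "\<exists>a\<in>codes I. box a \<noteq> {} \<and> box a \<subseteq> box r \<and> h ` box a \<subseteq> U" if V: "U \<in> \<V>" for U
      proof -
        have U: "openin X U" "U \<noteq> {}" "U \<subseteq> G"
          using U V by (auto simp: \<V>_def small_local_pi_base_def)
        obtain x where x: "x \<in> box r" "h x \<in> U"
          using meets[OF U] by blast
        then have xt: "x \<in> topspace Y"
          using box_topspace by blast
        obtain a where a: "a \<in> codes I" "x \<in> box a" "h ` box a \<subseteq> U"
          by (rule box_preimage_nbhd[OF U(1) xt x(2)])
        show ?thesis
          using codes_Un[OF a(1) r(1)] a(2,3) x(1) by (intro bexI[of _ "a \<union> r"]) (auto simp: box_Un)
      qed
      then obtain a where a: "\<And>U. U \<in> \<V> \<Longrightarrow> a U \<in> codes I \<and> box (a U) \<noteq> {} \<and> box (a U) \<subseteq> box r \<and> h ` box (a U) \<subseteq> U"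
        by metis
      \<comment> \<open>The pairs have disjoint coordinates, so if each met \<open>T\<close> then
        \<open>T\<close> would be at least as large as \<open>S\<close>. Including
        \<open>Domain b\<close> ensures that a pair missing \<open>T\<close> belongs to
        \<open>S'\<close>.\<close>
      define T where "T = Domain b \<union> (\<Union>U\<in>\<V>. Domain (a U))"
      have "|\<V>| <o \<tau>"
        using U small_subset[of \<U> \<V>] by (auto simp: small_local_pi_base_def \<V>_def)
      moreover have "|Domain (a U)| <o \<tau>" if "U \<in> \<V>" for U
        using a[OF that] codes_finite_Domain small_finite by blast
      moreover have "|Domain b| <o \<tau>"
        using b(1) codes_finite_Domain small_finite by blast
      ultimately have T: "|T| <o \<tau>"
        unfolding T_def by (intro small_Un small_UN)
      have "\<exists>q\<in>S. pair_domain q \<inter> T = {}"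
      proof (rule ccontr)
        assume "\<not> ?thesis"
        then have "\<forall>q\<in>S. \<exists>i. i \<in> pair_domain q \<inter> T" by blast
        then obtain f where f: "\<And>q. q \<in> S \<Longrightarrow> f q \<in> pair_domain q \<inter> T" by metis
        have "inj_on f S"
          by (rule inj_onI, rule ccontr) (metis disj f IntD1 IntI empty_iff)
        moreover have "f ` S \<subseteq> T"
          using f by blast
        ultimately have "|S| \<le>o |T|"
          using card_of_ordLeq by blast
        then show False
          using T large ordLeq_ordLess_trans by blast
      qed
      then obtain q where q: "q \<in> S" "pair_domain q \<inter> T = {}" ..
      then have "q \<in> S'"
        by (auto simp: S'_def T_def)
      obtain V W where VW: "openin X V" "openin X W" "V \<inter> W = {}"
        "h ` box (r \<union> fst q) \<subseteq> V" "h ` box (r \<union> snd q) \<subseteq> W"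
        using Sq(5)[OF q(1)] unfolding splits_def by blast
      have "z \<in> box (r \<union> fst q)"
        using zr z(2) \<open>q \<in> S'\<close> by (auto simp: box_Un)
      then have "openin X (V \<inter> G)" "h z \<in> V \<inter> G"
        using VW G zb b(3) by auto
      then obtain U where U: "U \<in> \<U>" "U \<subseteq> V \<inter> G"
        using U unfolding small_local_pi_base_def by blast
      then have UV: "U \<in> \<V>"
        by (auto simp: \<V>_def)
      \<comment> \<open>The box of \<open>a U\<close> ignores the coordinates of \<open>q\<close>,
        so it meets the second alternative. It also lies in the box of \<open>r\<close>, so a common
        point is sent into \<open>W\<close> and into \<open>U\<close>, a subset of
        \<open>V\<close>.\<close>
      have "Domain (a U) \<inter> Domain (snd q) = {}"
        using q(2) UV by (auto simp: T_def)
      then obtain w where "w \<in> box (a U)" "w \<in> box (snd q)"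
        using box_Int_nonempty[of "a U" "snd q"] a[OF UV] Sq(4)[OF q(1)] by blast
      then have "h w \<in> U" "h w \<in> W"
        using a[OF UV] VW(5) by (auto simp: box_Un)
      then show False
        using U(2) VW(3) by blast
    qed
  qed
qed

lemma ex_no_small_local_pi_base:
  assumes "\<not> weight X <o \<tau>"
  shows "\<exists>p\<in>topspace X. \<forall>\<U>. \<not> small_local_pi_base p \<U>"
  using ex_large_splitting[OF assms] large_splitting_no_small_local_pi_base by meson

end

section \<open>Neighbourhoods containing no image of a rich box over few coordinates\<close>

context small_product_image begin

text \<open>If every neighbourhood of \<open>p\<close> contained such an image, the interiors of the
  closures of these images would form a small local \<pi>-base at \<open>p\<close>. A homeomorphism
  would carry it to a point that has none.\<close>

lemma homogeneous_nbhd_avoiding_boxes: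
  assumes hom: "homogeneous_space X" and large: "\<not> weight X <o \<tau>"
    and J: "J \<subseteq> I" "|J| <o \<tau>" and p: "p \<in> topspace X"
  shows "\<exists>V. openin X V \<and> p \<in> V \<and> (\<forall>c\<in>codes J. rich c \<longrightarrow> \<not> h ` box c \<subseteq> V)"
proof (rule ccontr)
  assume no: "\<not> ?thesis"
  define \<U> where "\<U> = (\<lambda>c. X interior_of (X closure_of (h ` box c))) ` (codes J \<inter> Collect rich)"
  have smallU: "|\<U>| <o \<tau>"
    unfolding \<U>_def using small_codes[OF J] small_subset by (intro small_image) blast
  have openU: "\<forall>U\<in>\<U>. openin X U \<and> U \<noteq> {}"
    by (auto simp: \<U>_def rich_def)
  have nbhd: "\<exists>U\<in>\<U>. U \<subseteq> V" if V: "openin X V" "p \<in> V" for V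
  proof -
    obtain V' where V': "openin X V'" "p \<in> V'" "X closure_of V' \<subseteq> V"
      by (rule compactum_shrink[OF image V])
    then obtain c where c: "c \<in> codes J" "rich c" "h ` box c \<subseteq> V'"
      using no by blast
    have "X interior_of (X closure_of (h ` box c)) \<subseteq> X closure_of V'"
      by (meson c(3) closure_of_mono interior_of_subset subset_trans)
    then show ?thesis
      using c(1,2) V'(3) unfolding \<U>_def by blast
  qed
  obtain q where q: "q \<in> topspace X" "\<forall>\<U>. \<not> small_local_pi_base q \<U>"
    using ex_no_small_local_pi_base[OF large] by meson
  obtain f where f: "homeomorphic_map X X f" "f p = q"
    using hom p q(1) unfolding homogeneous_space_def by blast
  have "small_local_pi_base q ((`) f ` \<U>)"
    unfolding small_local_pi_base_def
  proof (intro conjI ballI allI impI)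
    show "|(`) f ` \<U>| <o \<tau>"
      by (rule small_image[OF smallU])
    fix U assume "U \<in> (`) f ` \<U>"
    then obtain U' where U': "U' \<in> \<U>" "U = f ` U'" ..
    then show "openin X U"
      using openU homeomorphic_map_openness_eq[OF f(1)] openin_subset
        homeomorphic_imp_open_map[OF f(1)] unfolding open_map_def by blast
    show "U \<noteq> {}"
      using U' openU by blast
  next
    fix V assume V: "openin X V \<and> q \<in> V"
    then have "openin X {x \<in> topspace X. f x \<in> V}"
      using openin_continuous_map_preimage[OF homeomorphic_imp_continuous_map[OF f(1)]] by simp
    then obtain U where "U \<in> \<U>" "U \<subseteq> {x \<in> topspace X. f x \<in> V}"
      using nbhd[of "{x \<in> topspace X. f x \<in> V}"] p f(2) V by auto
    then show "\<exists>U\<in>(`) f ` \<U>. U \<subseteq> V"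
      by blast
  qed
  then show False
    using q(2) by blast
qed

end

context product_image begin

text \<open>If \<open>J\<close> is not small compared to \<open>\<kappa>\<close>, then the successor of \<open>|J|\<close> is still at most the
  weight and takes over the role of \<open>\<kappa>\<close>.\<close>
lemma nbhd_avoiding_boxes:
  fixes \<kappa> :: "'k rel"
  assumes hom: "homogeneous_space X"
    and \<kappa>: "regular_cardinal \<kappa>" "natLeq <o \<kappa>" "\<kappa> \<le>o weight X" "\<And>i. i \<in> I \<Longrightarrow> |Bs i| <o \<kappa>"
    and J: "J \<subseteq> I" "|J| <o weight X" and p: "p \<in> topspace X"
  shows "\<exists>V. openin X V \<and> p \<in> V \<and> (\<forall>c\<in>codes J. rich c \<longrightarrow> \<not> h ` box c \<subseteq> V)"
proof (cases "|J| <o \<kappa>")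
  case True
  interpret small_product_image Xs I X h Bs \<kappa>
    by unfold_locales (use \<kappa> in auto)
  show ?thesis
    using homogeneous_nbhd_avoiding_boxes[OF hom _ J(1) True p] \<kappa>(3) not_ordLess_ordLeq by blast
next
  case False
  have C\<kappa>: "Cinfinite \<kappa>"
    using \<kappa>(1) by (simp add: regular_cardinal_def)
  then have le: "\<kappa> \<le>o |J|"
    using False by (meson card_of_Well_order card_order_on_well_order_on not_ordLess_iff_ordLeq)
  then have less: "\<kappa> <o cardSuc |J|"
    using cardSuc_greater[OF card_of_Card_order] ordLeq_ordLess_trans by blast
  have "Cinfinite |J|"
    using C\<kappa> le cinfinite_mono card_of_Card_order by blast
  then have infJ: "infinite J"
    by (simp add: cinfinite_def Field_card_of)
  have "regular_cardinal (cardSuc |J| )"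
    unfolding regular_cardinal_def
    using Cinfinite_cardSuc[OF \<open>Cinfinite |J|\<close>] infinite_cardSuc_regularCard[OF _ card_of_Card_order, of J] infJ
    by (simp add: Field_card_of)
  moreover have "natLeq <o cardSuc |J|"
    using \<kappa>(2) less ordLess_transitive by blast
  moreover have "|Bs i| <o cardSuc |J|" if "i \<in> I" for i
    using \<kappa>(4)[OF that] less ordLess_transitive by blast
  ultimately interpret small_product_image Xs I X h Bs "cardSuc |J|"
    by unfold_locales auto
  have "cardSuc |J| \<le>o weight X"
    using cardSuc_least[OF card_of_Card_order _ J(2)] Cinfinite_weight by blast
  then show ?thesis
    using homogeneous_nbhd_avoiding_boxes[OF hom _ J(1) cardSuc_greater[OF card_of_Card_order] p]
      not_ordLess_ordLeq by blast
qed

subsection \<open>Selecting the base\<close>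

text \<open>Cover the preimage of the closure of \<open>W\<close> by finitely many boxes mapped into
  \<open>V\<close>, and let \<open>N\<close> be their coordinates. If \<open>c\<close> avoided
  \<open>N - J\<close>, its restriction to \<open>N\<close> would be a rich code over
  \<open>J\<close> whose image is still inside \<open>V\<close>.\<close>

lemma nbhd_forcing_coordinates:
  assumes J: "J \<subseteq> I" and V: "openin X V" "p \<in> V" "\<forall>c\<in>codes J. rich c \<longrightarrow> \<not> h ` box c \<subseteq> V"
  shows "\<exists>W N. openin X W \<and> p \<in> W \<and> finite N \<and> N \<subseteq> I \<and>
    (\<forall>c\<in>codes I. rich c \<and> h ` box c \<subseteq> W \<longrightarrow> Domain c \<inter> (N - J) \<noteq> {})"
proof -
  obtain W where W: "openin X W" "p \<in> W" "X closure_of W \<subseteq> V"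
    by (rule compactum_shrink[OF image V(1,2)])
  let ?K = "{y \<in> topspace Y. h y \<in> X closure_of W}"
  have K: "compactin Y ?K"
    by (intro closedin_compact_space compactum_Y closedin_preimage) simp
  have "\<exists>c\<in>codes I. h ` box c \<subseteq> V \<and> y \<in> box c" if "y \<in> ?K" for y
  proof -
    have y: "y \<in> topspace Y" "h y \<in> V"
      using that W(3) by auto
    show ?thesis
      by (rule box_preimage_nbhd[OF V(1) y]) blast
  qed
  then obtain D where D: "finite D" "D \<subseteq> {c \<in> codes I. h ` box c \<subseteq> V}" "?K \<subseteq> \<Union>(box ` D)"
    using compactin_box_cover[OF K, of "\<lambda>c. h ` box c \<subseteq> V"] by meson
  define N where "N = \<Union>(Domain ` D)"
  have "finite N"
    using D(1,2) codes_finite_Domain unfolding N_def by blast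
  moreover have "N \<subseteq> I"
    using D(2) codes_Domain unfolding N_def by blast
  moreover have "\<forall>c\<in>codes I. rich c \<and> h ` box c \<subseteq> W \<longrightarrow> Domain c \<inter> (N - J) \<noteq> {}"
  proof (intro ballI impI notI)
    fix c assume "c \<in> codes I" "rich c \<and> h ` box c \<subseteq> W"
    then have c: "c \<in> codes I" "rich c" "h ` box c \<subseteq> W"
      by auto
    assume dom: "Domain c \<inter> (N - J) = {}"
    let ?c = "restrict_code c N" and ?d = "c - N \<times> UNIV"
    have "?c \<in> codes J"
      using c(1) dom by (fastforce simp: codes_def Fpow_def)
    moreover have "rich ?c"
      using rich_antimono[OF c(2)] by blast
    moreover have "h ` box ?c \<subseteq> V"
    proof
      fix x assume "x \<in> h ` box ?c"
      then obtain y where y: "y \<in> box ?c" "x = h y" by blast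
      then have yt: "y \<in> topspace Y"
        using box_topspace by blast
      have "box ?d \<noteq> {}"
        using rich_nonempty[OF c(2)] box_antimono[of ?d c] by blast
      \<comment> \<open>Change \<open>y\<close> outside \<open>N\<close> so that it satisfies all of
        \<open>c\<close>. The new point lies in a box of the cover, and that box depends on
        \<open>N\<close> only, so it contains \<open>y\<close> too.\<close>
      then have "\<exists>z\<in>topspace Y. (\<forall>c\<in>{?d}. z \<in> box c) \<and> (\<forall>i. i \<notin> \<Union>(Domain ` {?d}) \<longrightarrow> z i = y i)"
        by (intro box_glue[OF yt]) auto
      then obtain z where z: "z \<in> topspace Y" "z \<in> box ?d" "\<And>i. i \<in> N \<Longrightarrow> z i = y i"
        by auto
      have "z \<in> box ?c"
        by (rule box_cong[OF y(1) z(1)]) (use z(3) in blast)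
      then have "z \<in> box c"
        using z(2) box_Un[of ?c ?d] by (simp add: Int_Diff_Un)
      then have "h z \<in> W"
        using c(3) by blast
      then have "h z \<in> X closure_of W"
        using closure_of_subset[OF openin_subset[OF W(1)]] by blast
      then obtain d where d: "d \<in> D" "z \<in> box d"
        using D(3) z(1) by blast
      have "y \<in> box d"
        by (rule box_cong[OF d(2) yt]) (rule z(3)[symmetric], use d(1) in \<open>unfold N_def, blast\<close>)
      then show "x \<in> V"
        using y(2) D(2) d(1) by blast
    qed
    ultimately show False
      using V(3) by blast
  qed
  ultimately show ?thesis
    using W(1,2) by (intro exI conjI)
qed

definition forces_coordinates :: "'i set \<Rightarrow> 'i set \<Rightarrow> 'b set \<Rightarrow> bool" where
  "forces_coordinates J N W \<longleftrightarrow>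
     (\<forall>c\<in>codes I. rich c \<and> h ` box c \<subseteq> W \<longrightarrow> Domain c \<inter> (N - J) \<noteq> {})"

lemma forces_coordinates_mono:
  assumes "forces_coordinates J N W" "N \<subseteq> N'" "W' \<subseteq> W"
  shows "forces_coordinates J N' W'"
  unfolding forces_coordinates_def
proof (intro ballI impI)
  fix c assume c: "c \<in> codes I" "rich c \<and> h ` box c \<subseteq> W'"
  then have "rich c \<and> h ` box c \<subseteq> W"
    using assms(3) by (meson subset_trans)
  then have "Domain c \<inter> (N - J) \<noteq> {}"
    using assms(1) c(1) by (simp add: forces_coordinates_def)
  then show "Domain c \<inter> (N' - J) \<noteq> {}"
    using assms(2) by blast
qed

text \<open>Forcing survives shrinking \<open>W\<close> and enlarging \<open>N\<close>, so the
  neighbourhoods can be taken from \<open>B\<close> and the finite sets merged into one.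
  Nonemptiness is recorded because rich boxes are found inside nonempty open sets.\<close>

lemma finite_forcing_cover:
  assumes nbhds: "\<And>p. p \<in> topspace X \<Longrightarrow>
      \<exists>V. openin X V \<and> p \<in> V \<and> (\<forall>c\<in>codes J. rich c \<longrightarrow> \<not> h ` box c \<subseteq> V)"
    and J: "J \<subseteq> I" and B: "is_base X B" and K: "closedin X K" "K \<subseteq> U" "openin X U"
  shows "\<exists>N C. finite N \<and> N \<subseteq> I \<and> finite C \<and> C \<subseteq> B \<and> K \<subseteq> \<Union>C \<and>
    (\<forall>W\<in>C. W \<noteq> {} \<and> W \<subseteq> U \<and> forces_coordinates J N W)"
proof -
  let ?P = "\<lambda>W N. finite N \<and> N \<subseteq> I \<and> W \<noteq> {} \<and> W \<subseteq> U \<and> forces_coordinates J N W"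
  let ?B = "{W \<in> B. \<exists>N. ?P W N}"
  have "K \<subseteq> \<Union>?B"
  proof
    fix p assume p: "p \<in> K"
    then have "p \<in> topspace X"
      using closedin_subset[OF K(1)] by blast
    then obtain V where "openin X V" "p \<in> V" "\<forall>c\<in>codes J. rich c \<longrightarrow> \<not> h ` box c \<subseteq> V"
      using nbhds by meson
    then obtain V' N where V': "openin X V'" "p \<in> V'" "finite N" "N \<subseteq> I" "forces_coordinates J N V'"
      using nbhd_forcing_coordinates[OF J, folded forces_coordinates_def] by meson
    have "openin X (V' \<inter> U)" "p \<in> V' \<inter> U"
      using V' K p by auto
    then obtain W where W: "W \<in> B" "p \<in> W" "W \<subseteq> V' \<inter> U"
      by (rule is_base_nbhd[OF B])
    then have "?P W N"
      using V' forces_coordinates_mono[OF V'(5) order_refl, of W] by blast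
    then show "p \<in> \<Union>?B"
      using W by blast
  qed
  moreover have "\<forall>W\<in>?B. openin X W"
    using is_base_openin[OF B] by blast
  moreover have "compactin X K"
    using image K(1) by (simp add: compactum_def closedin_compact_space)
  ultimately obtain C where C: "finite C" "C \<subseteq> ?B" "K \<subseteq> \<Union>C"
    unfolding compactin_def by meson
  then have "\<forall>W\<in>C. \<exists>N. ?P W N"
    by blast
  then obtain N where N: "\<forall>W\<in>C. ?P W (N W)"
    by metis
  let ?N = "\<Union>(N ` C)"
  have "forces_coordinates J ?N W" if "W \<in> C" for W
    by (rule forces_coordinates_mono[of J "N W" W]) (use N that in auto)
  then have "\<forall>W\<in>C. W \<noteq> {} \<and> W \<subseteq> U \<and> forces_coordinates J ?N W"
    using N by blast
  moreover have "finite ?N" "?N \<subseteq> I" "C \<subseteq> B"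
    using N C(1,2) by auto
  ultimately show ?thesis
    using C(1,3) by (intro exI conjI)
qed

text \<open>\<open>nbhds\<close> ranges over all \<open>J\<close> below the weight, since this is
  the bound obtained for the coordinates spent before a stage of the recursion.\<close>

lemma base_contains_finitely_op_like_base:
  assumes nbhds: "\<And>J p. J \<subseteq> I \<Longrightarrow> |J| <o weight X \<Longrightarrow> p \<in> topspace X \<Longrightarrow>
      \<exists>V. openin X V \<and> p \<in> V \<and> (\<forall>c\<in>codes J. rich c \<longrightarrow> \<not> h ` box c \<subseteq> V)"
    and B: "is_base X B"
  shows "\<exists>C\<subseteq>B. is_base X C \<and> (\<forall>U\<in>C. finite {V \<in> C. U \<subseteq> V})"
proof -
  obtain B1 where B1: "is_base X B1" "|B1| \<le>o weight X"
    by (rule ex_base_le_weight)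
  define T where "T = {(U, V). U \<in> B1 \<and> V \<in> B1 \<and> X closure_of U \<subseteq> V}"
  have "|T| \<le>o |B1 \<times> B1|"
    by (rule card_of_mono1) (auto simp: T_def)
  also have "|B1 \<times> B1| \<le>o weight X"
    using B1(2) Cinfinite_weight by (intro card_of_Sigma_ordLeq_infinite_Field) (auto simp: cinfinite_def)
  finally have T: "|T| \<le>o weight X" .
  \<comment> \<open>Ordering the tasks in type \<open>|T|\<close> gives each of them fewer than w(X)
    predecessors.\<close>
  define r where "r = |T|"
  have r: "Well_order r" "Field r = T" "Card_order r"
    by (simp_all add: r_def card_of_well_order_on Field_card_of card_of_card_order_on)
  have under_T: "underS r t \<subseteq> T" for t
    using r(2) by (auto simp: underS_def Field_def)
  have under_small: "|underS r t| <o weight X" if "t \<in> T" for t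
    using card_of_underS[OF r(3)] that r(2) T ordLess_ordLeq_trans unfolding r_def by blast
  define past where "past f t = (\<Union>s\<in>underS r t. fst (f s))"
    for f :: "'b set \<times> 'b set \<Rightarrow> 'i set \<times> 'b set set" and t
  \<comment> \<open>The guard \<open>t \<in> T\<close> lets a value exist at every argument, and
    \<open>past f t\<close> reads \<open>f\<close> only strictly below \<open>t\<close>; both are
    needed for well-founded choice.\<close>
  define good where "good f t = (\<lambda>(N, C). t \<in> T \<longrightarrow> finite N \<and> N \<subseteq> I \<and> finite C \<and> C \<subseteq> B \<and>
      X closure_of (fst t) \<subseteq> \<Union>C \<and> (\<forall>W\<in>C. W \<noteq> {} \<and> W \<subseteq> snd t \<and> forces_coordinates (past f t) N W))"
    for f t
  have "\<exists>f. \<forall>t. good f t (f t)"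
  proof (rule dependent_wf_choice)
    show "wf (r - Id)"
      using r(1) by (simp add: well_order_on_def)
    show "good f t x = good g t x" if "\<And>s. (s, t) \<in> r - Id \<Longrightarrow> f s = g s" for f g t x
    proof -
      have "past f t = past g t"
        unfolding past_def by (rule SUP_cong) (auto simp: underS_def that)
      then show ?thesis
        by (simp add: good_def)
    qed
    show "\<exists>x. good f t x" if IH: "\<And>s. (s, t) \<in> r - Id \<Longrightarrow> good f s (f s)" for t f
    proof (cases "t \<in> T")
      case True
      have past: "finite (fst (f s)) \<and> fst (f s) \<subseteq> I" if "s \<in> underS r t" for s
      proof -
        have "s \<in> T"
          using that under_T by blast
        moreover have "(s, t) \<in> r - Id"
          using that by (simp add: underS_def)
        ultimately show ?thesis
          using IH[of s] by (auto simp: good_def split_beta)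
      qed
      then have "past f t \<subseteq> I"
        by (auto simp: past_def)
      moreover have "|past f t| <o weight X"
        unfolding past_def using past under_small[OF True]
        by (intro UN_finite_ordLess_Cinfinite Cinfinite_weight) auto
      moreover have "X closure_of fst t \<subseteq> snd t" "openin X (snd t)"
        using True is_base_openin[OF B1(1)] by (auto simp: T_def)
      ultimately show ?thesis
        using finite_forcing_cover[OF nbhds _ B closedin_closure_of, of "past f t" "fst t" "snd t"]
        by (auto simp: good_def)
    qed (auto simp: good_def)
  qed
  then obtain f where f: "\<And>t. good f t (f t)" by blast
  define N where "N t = fst (f t)" for t
  define C where "C t = snd (f t)" for t
  define P where "P t = (\<Union>s\<in>underS r t. N s)" for t
  have NC: "finite (C t)" "C t \<subseteq> B" "X closure_of (fst t) \<subseteq> \<Union>(C t)"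
    "\<And>W. W \<in> C t \<Longrightarrow> W \<noteq> {} \<and> W \<subseteq> snd t \<and> forces_coordinates (P t) (N t) W" if "t \<in> T" for t
    using f[of t] that by (auto simp: good_def split_beta N_def C_def P_def past_def)
  have "is_base X (\<Union>t\<in>T. C t)"
    unfolding is_base_iff
  proof (intro conjI ballI allI impI)
    fix V assume "V \<in> (\<Union>t\<in>T. C t)"
    then show "openin X V"
      using NC(2) is_base_openin[OF B] by blast
  next
    fix U x assume Ux: "openin X U \<and> x \<in> U"
    then obtain V where V: "V \<in> B1" "x \<in> V" "V \<subseteq> U"
      using B1(1) unfolding is_base_iff by meson
    then obtain W where W: "openin X W" "x \<in> W" "X closure_of W \<subseteq> V"
      using compactum_shrink[OF image is_base_openin[OF B1(1)]] by metis
    \<comment> \<open>Passing from \<open>W\<close> to a member of \<open>B1\<close> turns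
      \<open>V\<close> into the target of a task whose cover contains \<open>x\<close>.\<close>
    then obtain W' where W': "W' \<in> B1" "x \<in> W'" "W' \<subseteq> W"
      using B1(1) unfolding is_base_iff by meson
    then have t: "(W', V) \<in> T"
      using V W closure_of_mono[of W' W X] by (auto simp: T_def)
    have "x \<in> X closure_of W'"
      using closure_of_subset[OF openin_subset[OF is_base_openin[OF B1(1) W'(1)]]] W'(2) by blast
    then obtain S where "S \<in> C (W', V)" "x \<in> S"
      using NC(3)[OF t] by auto
    then show "\<exists>S\<in>\<Union>t\<in>T. C t. x \<in> S \<and> S \<subseteq> U"
      using NC(4)[OF t] V(3) t by fastforce
  qed
  moreover have "(\<Union>t\<in>T. C t) \<subseteq> B"
    using NC(2) by blast
  moreover have "finite {V \<in> (\<Union>t\<in>T. C t). U \<subseteq> V}" if U: "U \<in> (\<Union>t\<in>T. C t)" for U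
  proof -
    have "openin X U" "U \<noteq> {}"
      using U NC(2,4) is_base_openin[OF B] by blast+
    then obtain c where c: "c \<in> codes I" "rich c" "h ` box c \<subseteq> U"
      by (rule rich_dense)
    \<comment> \<open>A task with a selected superset of \<open>U\<close> uses a coordinate of
      \<open>c\<close> that is new at that task. Of two tasks, the coordinates of the earlier belong
      to the past of the later, so distinct tasks use distinct coordinates.\<close>
    let ?T = "{t \<in> T. Domain c \<inter> (N t - P t) \<noteq> {}}"
    have "\<forall>t\<in>?T. \<exists>i. i \<in> Domain c \<inter> (N t - P t)"
      by blast
    from bchoice[OF this] obtain k where k: "\<forall>t\<in>?T. k t \<in> Domain c \<inter> (N t - P t)" ..
    have "inj_on k ?T"
    proof (rule inj_onI, rule ccontr)
      fix s t assume st: "s \<in> ?T" "t \<in> ?T" "k s = k t" "s \<noteq> t"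
      then have "(s, t) \<in> r \<or> (t, s) \<in> r"
        using r(1,2) unfolding well_order_on_def linear_order_on_def total_on_def by blast
      then have "s \<in> underS r t \<or> t \<in> underS r s"
        using st(4) by (auto simp: underS_def)
      then have "N s \<subseteq> P t \<or> N t \<subseteq> P s"
        unfolding P_def by blast
      moreover have "k s \<in> N s - P s" "k t \<in> N t - P t"
        using bspec[OF k st(1)] bspec[OF k st(2)] by blast+
      ultimately show False
        using st(3) by auto
    qed
    moreover have "k ` ?T \<subseteq> Domain c"
      using k by blast
    ultimately have "finite ?T"
      using codes_finite_Domain[OF c(1)] by (meson finite_imageD finite_subset)
    then have "finite (\<Union>t\<in>?T. C t)"
      using NC(1) by blast
    moreover have "{V \<in> (\<Union>t\<in>T. C t). U \<subseteq> V} \<subseteq> (\<Union>t\<in>?T. C t)"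
    proof
      fix V assume "V \<in> {V \<in> (\<Union>t\<in>T. C t). U \<subseteq> V}"
      then obtain t where t: "t \<in> T" "V \<in> C t" "U \<subseteq> V" by blast
      then have "forces_coordinates (P t) (N t) V"
        using NC(4) by blast
      then have "Domain c \<inter> (N t - P t) \<noteq> {}"
        using c t(3) unfolding forces_coordinates_def by blast
      then show "V \<in> (\<Union>t\<in>?T. C t)"
        using t by blast
    qed
    ultimately show ?thesis
      by (rule finite_subset[rotated])
  qed
  ultimately show ?thesis
    by blast
qed

end

text \<open>For each pair from a base of minimal size that has a member of \<open>B\<close> in
  between, keep one such member; there are at most w(X) pairs.\<close>

lemma base_contains_base_le_weight:
  assumes "is_base X B"
  obtains C where "C \<subseteq> B" "is_base X C" "|C| \<le>o weight X"
proof -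
  obtain B1 where B1: "is_base X B1" "|B1| \<le>o weight X"
    by (rule ex_base_le_weight)
  let ?T = "{(U, V). U \<in> B1 \<and> V \<in> B1 \<and> (\<exists>W\<in>B. U \<subseteq> W \<and> W \<subseteq> V)}"
  define g where "g = (\<lambda>(U, V). SOME W. W \<in> B \<and> U \<subseteq> W \<and> W \<subseteq> V)"
  have g: "g (U, V) \<in> B \<and> U \<subseteq> g (U, V) \<and> g (U, V) \<subseteq> V" if "(U, V) \<in> ?T" for U V
  proof -
    have "\<exists>W. W \<in> B \<and> U \<subseteq> W \<and> W \<subseteq> V"
      using that by blast
    then show ?thesis
      unfolding g_def prod.case by (rule someI_ex)
  qed
  have "|g ` ?T| \<le>o |?T|"
    by (rule card_of_image)
  also have "|?T| \<le>o |B1 \<times> B1|"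
    by (rule card_of_mono1) auto
  also have "|B1 \<times> B1| \<le>o weight X"
    using B1(2) Cinfinite_weight by (intro card_of_Sigma_ordLeq_infinite_Field) (auto simp: cinfinite_def)
  finally have "|g ` ?T| \<le>o weight X" .
  moreover have "g ` ?T \<subseteq> B"
    using g by blast
  moreover have "is_base X (g ` ?T)"
    unfolding is_base_iff
  proof (intro conjI ballI allI impI)
    fix V assume "V \<in> g ` ?T"
    then show "openin X V"
      using g is_base_openin[OF assms] by blast
  next
    fix U x assume "openin X U \<and> x \<in> U"
    then obtain V where V: "V \<in> B1" "x \<in> V" "V \<subseteq> U"
      using B1(1) unfolding is_base_iff by meson
    then obtain W where W: "W \<in> B" "x \<in> W" "W \<subseteq> V"
      using assms is_base_openin[OF B1(1)] unfolding is_base_iff by meson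
    then obtain V' where V': "V' \<in> B1" "x \<in> V'" "V' \<subseteq> W"
      using B1(1) is_base_openin[OF assms] unfolding is_base_iff by meson
    have t: "(V', V) \<in> ?T"
      using V W V' by blast
    then show "\<exists>S\<in>g ` ?T. x \<in> S \<and> S \<subseteq> U"
      using g[OF t] V(3) V'(2) by (intro bexI[of _ "g (V', V)"] imageI) auto
  qed
  ultimately show thesis
    by (rule that[rotated 2])
qed

section \<open>The two cases of the theorem\<close>

lemma card_supD: "card_sup S mu \<Longrightarrow> Card_order mu" "card_sup S mu \<Longrightarrow> r \<in> S \<Longrightarrow> r \<le>o mu"
  by (auto simp: card_sup_def)

text \<open>The successor of \<open>r\<close> is regular but lives on another type; being at most
  \<open>w\<close>, it is copied onto a subset of \<open>Field w\<close>.\<close>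

lemma ex_regular_between:
  fixes r :: "'c rel" and w :: "'d rel"
  assumes "Cinfinite r" "r <o w" "Card_order w"
  obtains \<kappa> :: "'d rel" where "regular_cardinal \<kappa>" "r <o \<kappa>" "\<kappa> \<le>o w"
proof -
  have Suc: "Cinfinite (cardSuc r)" "regularCard (cardSuc r)"
    using assms(1) Cinfinite_cardSuc infinite_cardSuc_regularCard by (auto simp: cinfinite_def)
  have "cardSuc r \<le>o w"
    using assms cardSuc_least by blast
  then have le: "card_of (Field (cardSuc r)) \<le>o card_of (Field w)"
    by (rule card_of_mono2)
  obtain A where A: "A \<subseteq> Field w" "card_of (Field (cardSuc r)) =o card_of A"
    using iffD1[OF internalize_card_of_ordLeq2 le] by (elim exE conjE)
  have "card_of (Field (cardSuc r)) =o cardSuc r"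
    by (rule card_of_Field_ordIso) (simp add: Suc(1))
  then have iso: "cardSuc r =o card_of A"
    using A(2) by (meson ordIso_symmetric ordIso_transitive)
  show thesis
  proof (rule that)
    show "regular_cardinal |A|"
      unfolding regular_cardinal_def
      using regularCard_ordIso[OF iso Suc] Cinfinite_cong[OF iso Suc(1)] by blast
    show "r <o |A|"
      using assms(1) by (intro ordLess_ordIso_trans[OF cardSuc_greater iso]) simp
    show "|A| \<le>o w"
      by (rule ordLeq_ordIso_trans[OF card_of_mono1[OF A(1)] card_of_Field_ordIso[OF assms(3)]])
  qed
qed

theorem theorem3p33:
  fixes Xs :: "'i \<Rightarrow> 'a topology" and I :: "'i set"
    and X :: "'b topology" and h :: "('i \<Rightarrow> 'a) \<Rightarrow> 'b"
    and mu :: "('a set + nat) rel"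
  assumes "I \<noteq> {}"
    and "\<forall>i\<in>I. compactum (Xs i)"
    and "compactum X" and "homogeneous_space X"
    and "continuous_map (product_topology Xs I) X h"
    and "h ` topspace (product_topology Xs I) = topspace X"
    and "card_sup ((\<lambda>i. weight (Xs i)) ` I) mu"
  shows "((\<exists>\<kappa> :: ('b set + nat) rel. regular_cardinal \<kappa> \<and>
             (\<forall>i\<in>I. (weight (Xs i), \<kappa>) \<in> ordLess) \<and> (\<kappa>, weight X) \<in> ordLeq) \<longrightarrow>
           (\<forall>B. is_base X B \<longrightarrow> (\<exists>C\<subseteq>B. is_base X C \<and> op_like mu C)))
       \<and> ((\<not> (\<exists>\<kappa> :: ('b set + nat) rel. regular_cardinal \<kappa> \<and>
             (\<forall>i\<in>I. (weight (Xs i), \<kappa>) \<in> ordLess) \<and> (\<kappa>, weight X) \<in> ordLeq)) \<longrightarrow>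
           (weight X, mu) \<in> ordLeq \<and>
           (\<forall>B. is_base X B \<longrightarrow> (\<exists>C\<subseteq>B. is_base X C \<and> op_like (cardSuc (weight X)) C)))"
proof -
  obtain i0 where i0: "i0 \<in> I"
    using assms(1) by blast
  have weight_mu: "weight (Xs i) \<le>o mu" if "i \<in> I" for i
    using card_supD(2)[OF assms(7)] that by blast
  \<comment> \<open>Weights are infinite by convention and \<open>I\<close> is nonempty. Finitely
    many supersets are thus fewer than \<open>mu\<close>.\<close>
  have mu: "Cinfinite mu"
    using weight_mu[OF i0] Cinfinite_weight cinfinite_mono card_supD(1)[OF assms(7)] by blast
  have "\<exists>C\<subseteq>B. is_base X C \<and> op_like mu C"
    if \<kappa>: "regular_cardinal \<kappa>" "\<forall>i\<in>I. weight (Xs i) <o \<kappa>" "\<kappa> \<le>o weight X" and B: "is_base X B"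
    for \<kappa> :: "('b set + nat) rel" and B
  proof -
    have "\<forall>i. \<exists>B. is_base (Xs i) B \<and> |B| \<le>o weight (Xs i)"
      by (metis ex_base_le_weight)
    then obtain Bs where Bs: "\<And>i. is_base (Xs i) (Bs i)" "\<And>i. |Bs i| \<le>o weight (Xs i)"
      by metis
    interpret product_image Xs I X h Bs
      by unfold_locales (use assms Bs in auto)
    have "natLeq <o \<kappa>"
      using natLeq_ordLeq_cinfinite[OF Cinfinite_weight] \<kappa>(2) i0 ordLeq_ordLess_trans by blast
    moreover have "|Bs i| <o \<kappa>" if "i \<in> I" for i
      using Bs(2) \<kappa>(2) that ordLeq_ordLess_trans by blast
    ultimately have "\<exists>C\<subseteq>B. is_base X C \<and> (\<forall>U\<in>C. finite {V \<in> C. U \<subseteq> V})"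
      using \<kappa>(1,3) assms(4) by (intro base_contains_finitely_op_like_base[OF nbhd_avoiding_boxes B])
    then obtain C where C: "C \<subseteq> B" "is_base X C" "\<And>U. U \<in> C \<Longrightarrow> finite {V \<in> C. U \<subseteq> V}"
      by blast
    have "op_like mu C"
      unfolding op_like_def
    proof
      fix U assume "U \<in> C"
      then show "|{V \<in> C. U \<subseteq> V}| <o mu"
        using C(3) mu by (intro finite_ordLess_Cinfinite)
    qed
    then show ?thesis
      using C by blast
  qed
  moreover have "weight X \<le>o mu"
    if no: "\<nexists>\<kappa> :: ('b set + nat) rel. regular_cardinal \<kappa> \<and> (\<forall>i\<in>I. weight (Xs i) <o \<kappa>) \<and> \<kappa> \<le>o weight X"
  proof (rule ccontr)
    assume "\<not> weight X \<le>o mu"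
    moreover have "Well_order mu" "Card_order (weight X)" "Well_order (weight X)"
      using mu Cinfinite_weight[of X] by (auto intro: card_order_on_well_order_on)
    ultimately have less: "mu <o weight X"
      by (simp add: not_ordLeq_iff_ordLess)
    \<comment> \<open>The successor of \<open>mu\<close>, represented on the type of
      \<open>weight X\<close>, is a regular cardinal of the excluded kind.\<close>
    obtain \<kappa> :: "('b set + nat) rel" where \<kappa>: "regular_cardinal \<kappa>" "mu <o \<kappa>" "\<kappa> \<le>o weight X"
      by (rule ex_regular_between[OF mu less \<open>Card_order (weight X)\<close>])
    have "\<forall>i\<in>I. weight (Xs i) <o \<kappa>"
      using ordLeq_ordLess_trans[OF weight_mu \<kappa>(2)] by simp
    then show False
      using no \<kappa>(1,3) by blast
  qed
  moreover have "\<exists>C\<subseteq>B. is_base X C \<and> op_like (cardSuc (weight X)) C" if B: "is_base X B" for B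
  proof -
    obtain C where C: "C \<subseteq> B" "is_base X C" "|C| \<le>o weight X"
      by (rule base_contains_base_le_weight[OF B])
    have le: "|{V \<in> C. U \<subseteq> V}| \<le>o weight X" for U
      by (rule ordLeq_transitive[OF card_of_mono1 C(3)]) simp
    have less: "weight X <o cardSuc (weight X)"
      using Cinfinite_weight[of X] by (intro cardSuc_greater) simp
    have "op_like (cardSuc (weight X)) C"
      unfolding op_like_def by (rule ballI) (rule ordLeq_ordLess_trans[OF le less])
    then show ?thesis
      using C by blast
  qed
  ultimately show ?thesis
    by blast
qed

end
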